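(* There exist a vector lattice $F$ and a filtration $(E_n)$ on $F$ such that the space $\mathcal{M}_r=\mathcal{M}_r\bigl(F,(E_n)\bigr)$ of regular martingales, equipped with the coordinate-wise order, is not a vector lattice.
   Context: Let $F$ be a vector lattice. A filtration on $F$ is a sequence $(E_n)_{n\in\mathbb{N}}$ of positive (linear) projections on $F$ such that $E_nE_m=E_{n\wedge m}$ for all $n,m$, where $n\wedge m=\min(n,m)$. A sequence $X=(x_n)$ in $F$ is a martingale with respect to $(E_n)$ if $E_nx_m=x_n$ whenever $m\ge n$. The vector space of all martingales is denoted $\mathcal{M}=\mathcal{M}\bigl(F,(E_n)\bigr)$; it is ordered coordinate-wise ($X\le Y$ iff $x_n\le y_n$ for all $n$), with positive cone $\mathcal{M}_+$. The space of regular martingales is $\mathcal{M}_r=\{X_1-X_2 : X_1,X_2\in\mathcal{M}_+\}$ with the order inherited from $\mathcal{M}$. *)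

theory Defs
  imports "HOL-Algebra.Lattice" "HOL-Library.Function_Algebras" Complex_Main
begin

instantiation "fun" :: (type, real_vector) real_vector
begin

definition scaleR_fun :: "real \<Rightarrow> ('a \<Rightarrow> 'b) \<Rightarrow> 'a \<Rightarrow> 'b"
  where "scaleR_fun c f = (\<lambda>i. c *\<^sub>R f i)"

instance
  by standard (simp_all add: scaleR_fun_def fun_eq_iff scaleR_add_right scaleR_add_left)

end

text \<open>
  The underlying set of an ordered vector space is a linear subspace of an ambient real vector
  space \<open>'a\<close>. Only its linear structure comes from \<open>'a\<close>: the order is an arbitrary
  relation carried by the structure, unrelated to any order that the type \<open>'a\<close> may have.
\<close>

locale ordered_vector_space = partial_order V for V :: "'a::real_vector gorder" (structure) +
  assumes subspace_carrier: "subspace (carrier V)"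
    and add_right_mono:
      "\<lbrakk>x \<in> carrier V; y \<in> carrier V; z \<in> carrier V; x \<sqsubseteq> y\<rbrakk> \<Longrightarrow> x + z \<sqsubseteq> y + z"
    and scale_left_mono:
      "\<lbrakk>x \<in> carrier V; y \<in> carrier V; x \<sqsubseteq> y; 0 \<le> c\<rbrakk> \<Longrightarrow> c *\<^sub>R x \<sqsubseteq> c *\<^sub>R y"

locale vector_lattice = ordered_vector_space V + Lattice.lattice V
  for V :: "'a::real_vector gorder" (structure)

definition positive_cone :: "'a::real_vector gorder \<Rightarrow> 'a set"
  where "positive_cone V = {x \<in> carrier V. 0 \<sqsubseteq>\<^bsub>V\<^esub> x}"

locale positive_projection =
  fixes V :: "'a::real_vector gorder" (structure) and P :: "'a \<Rightarrow> 'a"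
  assumes maps_to: "x \<in> carrier V \<Longrightarrow> P x \<in> carrier V"
    and additive: "\<lbrakk>x \<in> carrier V; y \<in> carrier V\<rbrakk> \<Longrightarrow> P (x + y) = P x + P y"
    and homogeneous: "x \<in> carrier V \<Longrightarrow> P (c *\<^sub>R x) = c *\<^sub>R P x"
    and idempotent: "x \<in> carrier V \<Longrightarrow> P (P x) = P x"
    and positive: "x \<in> positive_cone V \<Longrightarrow> P x \<in> positive_cone V"

definition filtration :: "'a::real_vector gorder \<Rightarrow> (nat \<Rightarrow> 'a \<Rightarrow> 'a) \<Rightarrow> bool"
  where "filtration F E \<longleftrightarrow>
    (\<forall>n. positive_projection F (E n)) \<and>
    (\<forall>n m. \<forall>x\<in>carrier F. E n (E m x) = E (min n m) x)"

definition martingale ::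
    "'a::real_vector gorder \<Rightarrow> (nat \<Rightarrow> 'a \<Rightarrow> 'a) \<Rightarrow> (nat \<Rightarrow> 'a) \<Rightarrow> bool"
  where "martingale F E X \<longleftrightarrow>
    (\<forall>n. X n \<in> carrier F) \<and> (\<forall>n m. n \<le> m \<longrightarrow> E n (X m) = X n)"

definition martingales ::
    "'a::real_vector gorder \<Rightarrow> (nat \<Rightarrow> 'a \<Rightarrow> 'a) \<Rightarrow> (nat \<Rightarrow> 'a) gorder"
  where "martingales F E =
    \<lparr>carrier = {X. martingale F E X}, eq = (=), le = (\<lambda>X Y. \<forall>n. X n \<sqsubseteq>\<^bsub>F\<^esub> Y n)\<rparr>"

definition regular_martingales ::
    "'a::real_vector gorder \<Rightarrow> (nat \<Rightarrow> 'a \<Rightarrow> 'a) \<Rightarrow> (nat \<Rightarrow> 'a) gorder"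
  where "regular_martingales F E = (martingales F E)
    \<lparr>carrier := {X - Y | X Y. X \<in> positive_cone (martingales F E) \<and>
                              Y \<in> positive_cone (martingales F E)}\<rparr>"

text \<open>
  Martingales and regular martingales always form ordered vector spaces, so that the regular
  martingales can fail to be a vector lattice only for want of binary suprema or infima.
\<close>

lemma ordered_vector_space_martingales:
  assumes F: "ordered_vector_space F" and E: "filtration F E"
  shows "ordered_vector_space (martingales F E)"
proof -
  interpret F: ordered_vector_space F by (rule F)
  have P: "positive_projection F (E n)" for n
    using E by (simp add: filtration_def)
  note add = positive_projection.additive[OF P] and hom = positive_projection.homogeneous[OF P]
  have zero: "E n 0 = 0" for n
    using hom[of 0 n 0] F.subspace_carrier by (simp add: subspace_0)
  show ?thesis
  proof
    show "subspace (carrier (martingales F E))"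
      using F.subspace_carrier
      by (auto simp: martingales_def martingale_def subspace_def scaleR_fun_def add hom zero)
  next
    fix X Y assume "X \<sqsubseteq>\<^bsub>martingales F E\<^esub> Y" "Y \<sqsubseteq>\<^bsub>martingales F E\<^esub> X"
      "X \<in> carrier (martingales F E)" "Y \<in> carrier (martingales F E)"
    then show "X .=\<^bsub>martingales F E\<^esub> Y"
      by (auto simp: martingales_def martingale_def fun_eq_iff intro: F.le_antisym)
  next
    fix X Y Z assume "X \<sqsubseteq>\<^bsub>martingales F E\<^esub> Y" "Y \<sqsubseteq>\<^bsub>martingales F E\<^esub> Z"
      "X \<in> carrier (martingales F E)" "Y \<in> carrier (martingales F E)"
      "Z \<in> carrier (martingales F E)"
    then show "X \<sqsubseteq>\<^bsub>martingales F E\<^esub> Z"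
      by (auto simp: martingales_def martingale_def intro: F.le_trans)
  qed (auto simp: martingales_def martingale_def scaleR_fun_def
         intro: F.add_right_mono F.scale_left_mono)
qed

lemma ordered_vector_space_subspace:
  assumes V: "ordered_vector_space V" and U: "subspace U" "U \<subseteq> carrier V"
  shows "ordered_vector_space (V\<lparr>carrier := U\<rparr>)"
proof -
  interpret V: ordered_vector_space V by (rule V)
  show ?thesis
    using U by unfold_locales
      (auto simp: V.eq_is_equal subset_iff
         intro: V.le_antisym V.le_trans V.add_right_mono V.scale_left_mono)
qed

lemma ordered_vector_space_regular_martingales:
  assumes F: "ordered_vector_space F" and E: "filtration F E"
  shows "ordered_vector_space (regular_martingales F E)"
proof -
  interpret M: ordered_vector_space "martingales F E"
    by (rule ordered_vector_space_martingales[OF F E])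
  let ?C = "positive_cone (martingales F E)"
  let ?U = "{X - Y | X Y. X \<in> ?C \<and> Y \<in> ?C}"
  have zero: "0 \<in> ?C"
    using M.subspace_carrier by (simp add: positive_cone_def subspace_0)
  have add: "X + Y \<in> ?C" if "X \<in> ?C" "Y \<in> ?C" for X Y
  proof -
    have "0 + Y \<sqsubseteq>\<^bsub>martingales F E\<^esub> X + Y"
      using that M.subspace_carrier
      by (intro M.add_right_mono) (auto simp: positive_cone_def subspace_0)
    then show ?thesis
      using that M.subspace_carrier
      by (auto simp: positive_cone_def subspace_0 subspace_add intro: M.le_trans[of 0 Y])
  qed
  have scale: "c *\<^sub>R X \<in> ?C" if "X \<in> ?C" "0 \<le> c" for X c
    using M.scale_left_mono[of 0 X c] that M.subspace_carrier
    by (auto simp: positive_cone_def subspace_0 subspace_scale)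
  have "subspace ?U"
  proof (rule subspaceI)
    show "0 \<in> ?U" using zero by force
  next
    fix A B assume "A \<in> ?U" "B \<in> ?U"
    then obtain X Y X' Y' where "A = X - Y" "B = X' - Y'" "X \<in> ?C" "Y \<in> ?C" "X' \<in> ?C" "Y' \<in> ?C"
      by blast
    moreover from this have "A + B = (X + X') - (Y + Y')" by simp
    ultimately show "A + B \<in> ?U" using add by blast
  next
    fix c A assume "A \<in> ?U"
    then obtain X Y where A: "A = X - Y" "X \<in> ?C" "Y \<in> ?C" by blast
    show "c *\<^sub>R A \<in> ?U"
    proof (cases "0 \<le> c")
      case True
      have "c *\<^sub>R A = c *\<^sub>R X - c *\<^sub>R Y" by (simp add: A scaleR_diff_right)
      then show ?thesis using A scale True by blast
    next
      case False
      have "c *\<^sub>R A = (- c) *\<^sub>R Y - (- c) *\<^sub>R X" by (simp add: A scaleR_diff_right)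
      moreover have "0 \<le> - c" using False by simp
      ultimately show ?thesis using A scale by blast
    qed
  qed
  moreover have "?U \<subseteq> carrier (martingales F E)"
    using subspace_diff[OF M.subspace_carrier] by (auto simp: positive_cone_def)
  ultimately show ?thesis
    unfolding regular_martingales_def
    by (rule ordered_vector_space_subspace[OF M.ordered_vector_space_axioms])
qed

end

(* Let F be the eventually constant sequences, split the index set into the pairs {2k, 2k + 1},
   and let E n average over all pairs with k >= n. The martingale that is 0 on a pair with k even
   and that jumps at time k + 1 from 0 to (1, -1) on a pair with k odd is regular, being bounded
   by 1. A martingale Z dominating it and 0 has Z 0 >= 1/2 on every odd pair, hence on almost all
   pairs, as Z 0 is eventually constant. Replacing Z by 0 on one even pair far out gives a strictly
   smaller upper bound, so there is no least one. *)

theory Submission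
  imports Defs
begin

definition eventually_constant :: "(nat \<Rightarrow> real) set"
  where "eventually_constant = {f. \<exists>c. \<forall>\<^sub>F i in sequentially. f i = c}"

definition eventually_constant_lattice :: "(nat \<Rightarrow> real) gorder"
  where "eventually_constant_lattice = \<lparr>carrier = eventually_constant, eq = (=), le = (\<le>)\<rparr>"

lemma eventually_constantI:
  "(\<And>i. i \<ge> N \<Longrightarrow> f i = c) \<Longrightarrow> f \<in> eventually_constant"
  unfolding eventually_constant_def eventually_sequentially by blast

text \<open>Beyond both thresholds \<open>f\<close> and \<open>g\<close> are constant, hence so is
  any function of the two. An arbitrary \<open>h\<close> covers sums, scalings, suprema, infima and
  averages at once.\<close>

lemma eventually_constant_combine:
  assumes "f \<in> eventually_constant" "g \<in> eventually_constant"
  shows "(\<lambda>i. h (f i) (g i)) \<in> eventually_constant"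
proof -
  obtain c d where "\<forall>\<^sub>F i in sequentially. f i = c" "\<forall>\<^sub>F i in sequentially. g i = d"
    using assms by (auto simp: eventually_constant_def)
  then have "\<forall>\<^sub>F i in sequentially. h (f i) (g i) = h c d"
    by eventually_elim simp
  then show ?thesis by (auto simp: eventually_constant_def)
qed

lemma eventually_constant_cong:
  assumes "f \<in> eventually_constant" "\<And>i. i \<ge> N \<Longrightarrow> g i = f i"
  shows "g \<in> eventually_constant"
proof -
  obtain c where c: "\<forall>\<^sub>F i in sequentially. f i = c"
    using assms by (auto simp: eventually_constant_def)
  have "\<forall>\<^sub>F i in sequentially. g i = c"
    using c eventually_ge_at_top[of N] by eventually_elim (simp add: assms(2))
  then show ?thesis by (auto simp: eventually_constant_def)
qed

lemma subspace_eventually_constant: "subspace eventually_constant"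
proof (rule subspaceI)
  show "0 \<in> eventually_constant"
    by (rule eventually_constantI[of 0 _ 0]) simp
next
  fix f g assume "f \<in> eventually_constant" "g \<in> eventually_constant"
  then show "f + g \<in> eventually_constant"
    using eventually_constant_combine[of f g "(+)"] by (simp add: plus_fun_def)
next
  fix c f assume "f \<in> eventually_constant"
  then show "c *\<^sub>R f \<in> eventually_constant"
    using eventually_constant_combine[of f f "\<lambda>x _. c *\<^sub>R x"] by (simp add: scaleR_fun_def)
qed

lemma vector_lattice_eventually_constant: "vector_lattice eventually_constant_lattice"
proof
  show "subspace (carrier eventually_constant_lattice)"
    by (simp add: eventually_constant_lattice_def subspace_eventually_constant)
next
  fix f g assume fg: "f \<in> carrier eventually_constant_lattice" "g \<in> carrier eventually_constant_lattice"
  have "(\<lambda>i. max (f i) (g i)) \<in> eventually_constant" "(\<lambda>i. min (f i) (g i)) \<in> eventually_constant"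
    using fg by (auto simp: eventually_constant_lattice_def intro: eventually_constant_combine)
  then have "least eventually_constant_lattice (\<lambda>i. max (f i) (g i)) (Upper eventually_constant_lattice {f, g})"
    "greatest eventually_constant_lattice (\<lambda>i. min (f i) (g i)) (Lower eventually_constant_lattice {f, g})"
    using fg by (auto simp: eventually_constant_lattice_def least_def greatest_def Upper_def Lower_def le_fun_def)
  then show "\<exists>s. least eventually_constant_lattice s (Upper eventually_constant_lattice {f, g})"
    "\<exists>s. greatest eventually_constant_lattice s (Lower eventually_constant_lattice {f, g})"
    by blast+
qed (auto simp: eventually_constant_lattice_def le_fun_def scaleR_fun_def
    intro: mult_left_mono antisym order_trans)

text \<open>The involution swapping the two members of each pair; the pair containing
  \<open>i\<close> is numbered \<open>i div 2\<close>.\<close>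

definition sibling :: "nat \<Rightarrow> nat"
  where "sibling i = (if even i then Suc i else i - 1)"

lemma sibling_sibling [simp]: "sibling (sibling i) = i"
  by (auto simp: sibling_def)

lemma sibling_div_2 [simp]: "sibling i div 2 = i div 2"
  by (auto simp: sibling_def elim: oddE)

lemma even_sibling [simp]: "even (sibling i) \<longleftrightarrow> odd i"
  by (auto simp: sibling_def elim: oddE)

lemma eventually_constant_sibling:
  assumes "f \<in> eventually_constant"
  shows "(\<lambda>i. f (sibling i)) \<in> eventually_constant"
proof -
  obtain c N where c: "\<And>i. i \<ge> N \<Longrightarrow> f i = c"
    using assms by (auto simp: eventually_constant_def eventually_sequentially)
  \<comment> \<open>The threshold rises by one because \<open>sibling i\<close> may be
    \<open>i - 1\<close>.\<close>
  show ?thesis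
    by (rule eventually_constantI[of "Suc N" _ c]) (auto simp: sibling_def intro: c)
qed

text \<open>This is the conditional expectation for the partition of the indices into singletons
  below \<open>2 * n\<close> and whole pairs from there on.\<close>

definition pair_average :: "nat \<Rightarrow> (nat \<Rightarrow> real) \<Rightarrow> nat \<Rightarrow> real"
  where "pair_average n f i = (if i div 2 < n then f i else (f i + f (sibling i)) / 2)"

lemma filtration_pair_average: "filtration eventually_constant_lattice pair_average"
proof -
  \<comment> \<open>On each pair both operators are either the identity or the averaging, which is
    idempotent; the composite averages exactly the pairs numbered at least \<open>n\<close> or at
    least \<open>m\<close>. The case \<open>n = m\<close> is the idempotence needed below.\<close>
  have min: "pair_average n (pair_average m f) = pair_average (min n m) f" for n m f
    by (auto simp: fun_eq_iff pair_average_def field_simps)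
  have closed: "pair_average n f \<in> eventually_constant" if f: "f \<in> eventually_constant" for n f
  proof (rule eventually_constant_cong)
    \<comment> \<open>Averaging over every pair preserves eventual constancy, and
      \<open>pair_average n f\<close> deviates from that only below \<open>2 * n\<close>.\<close>
    show "(\<lambda>i. (f i + f (sibling i)) / 2) \<in> eventually_constant"
      using eventually_constant_combine[OF f eventually_constant_sibling[OF f]] .
    show "pair_average n f i = (f i + f (sibling i)) / 2" if "i \<ge> 2 * n" for i
      using that by (auto simp: pair_average_def)
  qed
  have "positive_projection eventually_constant_lattice (pair_average n)" for n
  proof
    fix f c
    show "pair_average n (c *\<^sub>R f) = c *\<^sub>R pair_average n f"
      by (auto simp: fun_eq_iff pair_average_def scaleR_fun_def algebra_simps)
  next
    fix f g
    show "pair_average n (f + g) = pair_average n f + pair_average n g"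
      by (auto simp: fun_eq_iff pair_average_def add_divide_distrib)
  next
    fix f
    show "pair_average n (pair_average n f) = pair_average n f"
      by (simp add: min)
  next
    fix f assume "f \<in> positive_cone eventually_constant_lattice"
    then show "pair_average n f \<in> positive_cone eventually_constant_lattice"
      by (auto simp: positive_cone_def eventually_constant_lattice_def closed le_fun_def pair_average_def)
  qed (simp add: eventually_constant_lattice_def closed)
  then show ?thesis
    by (simp add: filtration_def min)
qed

text \<open>The jumps are released one pair at a time, so that each \<open>jump_martingale n\<close>
  has finite support and lies in the lattice, although the pointwise limit in \<open>n\<close> is
  not eventually constant.\<close>

definition jump_martingale :: "nat \<Rightarrow> nat \<Rightarrow> real"
  where "jump_martingale n i =
    (if i div 2 < n \<and> odd (i div 2) then if even i then 1 else - 1 else 0)"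

abbreviation "M_r \<equiv> regular_martingales eventually_constant_lattice pair_average"

abbreviation "M_pos \<equiv> positive_cone (martingales eventually_constant_lattice pair_average)"

lemma M_pos_iff:
  "X \<in> M_pos \<longleftrightarrow> (\<forall>n. X n \<in> eventually_constant) \<and>
     (\<forall>n m. n \<le> m \<longrightarrow> pair_average n (X m) = X n) \<and> (\<forall>n i. 0 \<le> X n i)"
  by (auto simp: positive_cone_def martingales_def martingale_def eventually_constant_lattice_def
      le_fun_def)

lemma carrier_M_r: "carrier M_r = {X - Y | X Y. X \<in> M_pos \<and> Y \<in> M_pos}"
  by (simp add: regular_martingales_def)

lemma le_M_r: "X \<sqsubseteq>\<^bsub>M_r\<^esub> Y \<longleftrightarrow> (\<forall>n i. X n i \<le> Y n i)"
  by (auto simp: regular_martingales_def martingales_def eventually_constant_lattice_def le_fun_def)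

lemma zero_in_M_pos: "0 \<in> M_pos"
  by (auto simp: M_pos_iff pair_average_def fun_eq_iff intro: eventually_constantI)

lemma M_pos_subset_M_r: "M_pos \<subseteq> carrier M_r"
proof
  fix X assume "X \<in> M_pos"
  moreover have "X = X - 0" by simp
  ultimately show "X \<in> carrier M_r"
    unfolding carrier_M_r using zero_in_M_pos by blast
qed

text \<open>All values are at least -1, so adding the constant martingale 1 gives a positive one.
  The martingale property holds because 1 and -1 average to 0 on a pair whose jump is still to
  come.\<close>

lemma jump_martingale_in_M_r: "jump_martingale \<in> carrier M_r"
proof -
  have "(\<lambda>n i. 1 + jump_martingale n i) \<in> M_pos"
    unfolding M_pos_iff
  proof (intro conjI allI impI)
    show "(\<lambda>i. 1 + jump_martingale n i) \<in> eventually_constant" for n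
      by (rule eventually_constantI[of "2 * n" _ 1]) (auto simp: jump_martingale_def)
  qed (auto simp: fun_eq_iff pair_average_def jump_martingale_def)
  moreover have "(\<lambda>n i. 1) \<in> M_pos"
    by (auto simp: M_pos_iff pair_average_def intro: eventually_constantI)
  moreover have "jump_martingale = (\<lambda>n i. 1 + jump_martingale n i) - (\<lambda>n i. 1)"
    by (simp add: fun_eq_iff)
  ultimately show ?thesis
    unfolding carrier_M_r by blast
qed

lemma no_supremum_jump_martingale: "\<not> least M_r Z (Upper M_r {jump_martingale, 0})"
proof
  assume Z: "least M_r Z (Upper M_r {jump_martingale, 0})"
  have in_M_r: "{jump_martingale, 0} \<subseteq> carrier M_r"
    using jump_martingale_in_M_r M_pos_subset_M_r zero_in_M_pos by auto
  then have Z_car: "Z \<in> carrier M_r" and Z_jump: "jump_martingale n i \<le> Z n i" and Z_0: "0 \<le> Z n i" for n i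
    using Z by (auto simp: least_def Upper_def le_M_r)
  interpret M: ordered_vector_space "martingales eventually_constant_lattice pair_average"
    by (intro ordered_vector_space_martingales filtration_pair_average
        vector_lattice.axioms(1) vector_lattice_eventually_constant)
  have "Z \<in> carrier (martingales eventually_constant_lattice pair_average)"
    using Z_car subspace_diff[OF M.subspace_carrier] by (auto simp: carrier_M_r positive_cone_def)
  then have Z_pos: "Z \<in> M_pos"
    using Z_0 unfolding M_pos_iff
    by (simp add: martingales_def martingale_def eventually_constant_lattice_def)
  then obtain c N where c: "\<And>i. i \<ge> N \<Longrightarrow> Z 0 i = c"
    unfolding M_pos_iff eventually_constant_def eventually_sequentially by blast
  \<comment> \<open>\<open>j\<close> is the even member of the odd-numbered pair
    \<open>2 * N + 1\<close>. It lies beyond \<open>N\<close>, and as a time it is late enough for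
    the jump on that pair to have occurred.\<close>
  define j where "j = 4 * N + 2"
  have "pair_average 0 (Z j) = Z 0"
    using Z_pos by (simp add: M_pos_iff)
  then have "Z 0 j = (Z j j + Z j (sibling j)) / 2"
    by (auto simp: pair_average_def dest: fun_cong[of _ _ j])
  moreover have "Z j j \<ge> 1"
    using Z_jump[of j j] by (simp add: jump_martingale_def j_def)
  ultimately have "Z 0 j > 0"
    using Z_0[of j "sibling j"] by simp
  then have "c > 0"
    using c[of j] by (simp add: j_def)
  \<comment> \<open>An even-numbered pair, where \<open>jump_martingale\<close> vanishes, far enough
    out that \<open>Z 0\<close> equals \<open>c\<close> on it.\<close>
  define k where "k = 2 * N"
  define Z' where "Z' n i = (if i div 2 = k then 0 else Z n i)" for n i
  have "Z' \<in> M_pos"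
    unfolding M_pos_iff
  proof (intro conjI allI impI)
    fix n
    have "Z n \<in> eventually_constant"
      using Z_pos by (simp add: M_pos_iff)
    then show "Z' n \<in> eventually_constant"
      by (rule eventually_constant_cong[of _ "2 * k + 2"]) (auto simp: Z'_def)
  next
    fix n m :: nat assume "n \<le> m"
    then have "Z n = pair_average n (Z m)"
      using Z_pos by (simp add: M_pos_iff)
    \<comment> \<open>Erasing both members of a pair commutes with \<open>pair_average n\<close>,
      which never mixes different pairs.\<close>
    then show "pair_average n (Z' m) = Z' n"
      by (simp add: fun_eq_iff Z'_def pair_average_def)
  qed (simp add: Z'_def Z_0)
  moreover have "jump_martingale n i \<le> Z' n i" for n i
    using Z_jump[of n i] by (simp add: Z'_def jump_martingale_def k_def)
  ultimately have "Z' \<in> Upper M_r {jump_martingale, 0}"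
    using M_pos_subset_M_r by (auto simp: Upper_def le_M_r M_pos_iff)
  \<comment> \<open>Leastness of \<open>Z\<close> would force \<open>c\<close> to be at most 0 on
    the erased pair.\<close>
  then have "Z 0 (2 * k) \<le> Z' 0 (2 * k)"
    using Z by (auto simp: least_def le_M_r)
  then show False
    using c[of "2 * k"] \<open>c > 0\<close> by (simp add: Z'_def k_def)
qed

theorem mainTheorem2:
  shows "\<exists>(F :: (nat \<Rightarrow> real) gorder) (E :: nat \<Rightarrow> (nat \<Rightarrow> real) \<Rightarrow> nat \<Rightarrow> real).
    vector_lattice F \<and> filtration F E \<and> \<not> vector_lattice (regular_martingales F E)"
proof (intro exI conjI notI)
  \<comment> \<open>The witnesses left schematic by \<open>exI\<close> are fixed here, when
    \<open>show False\<close> discharges this assumption.\<close>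
  assume "vector_lattice M_r"
  then interpret M_r: vector_lattice M_r .
  have "0 \<in> carrier M_r"
    using M_pos_subset_M_r zero_in_M_pos by blast
  then show False
    using M_r.sup_of_two_exists[OF jump_martingale_in_M_r] no_supremum_jump_martingale by blast
qed (rule vector_lattice_eventually_constant filtration_pair_average)+

end
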